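(* Let $f\in\mathbf{H}_2(2^{-q}\mathbb{D})$ and $g\in\mathbf{H}_2(2^{-p}\mathbb{D})$, where $p,q\in\mathbb{N}$ and $p>q$. Then $fg\in\mathbf{H}_2(2^{-p}\mathbb{D})$. Furthermore, $$\|fg\|_{-p}\le\left(1-4^{-(p-q)}\right)^{-1}\|f\|_{-q}\|g\|_{-p}.$$
   Context: $\mathbb D$ is the open unit disk in $\mathbb C$. For an integer $p$, the Hardy space of the disk $2^{p}\mathbb D$ is, in terms of power series, $\mathbf H_2(2^{p}\mathbb D)=\{\sum_{n=0}^\infty a_nz^n:\sum_{n=0}^\infty|a_n|^2 2^{2np}<\infty\}$, with norm $\|\sum_n a_nz^n\|_p^2=\sum_{n=0}^\infty|a_n|^2 2^{2np}$. Thus $\|\sum_n a_n z^n\|_{-p}^2=\sum_n|a_n|^2 2^{-2np}$ is the norm of $\mathbf H_2(2^{-p}\mathbb D)$. The product of $f(z)=\sum a_nz^n$ and $g(z)=\sum b_nz^n$ is $(fg)(z)=\sum_{n=0}^\infty\big(\sum_{m=0}^n a_mb_{n-m}\big)z^n$. *)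

theory Defs
  imports Complex_Main "HOL-Computational_Algebra.Formal_Power_Series"
begin

text \<open>
  The Hardy space of the disk of radius \<open>2\<^sup>p\<close> and its norm, where \<open>p\<close> is any integer.
  Its elements are represented by their power series at \<open>0\<close>, so that the product is the
  Cauchy product, i.e. multiplication of formal power series.
\<close>

definition hardy2 :: "int \<Rightarrow> complex fps set" where
  "hardy2 p = {f. summable (\<lambda>n. (cmod (fps_nth f n))\<^sup>2 * 2 powi (2 * int n * p))}"

text \<open>Only meaningful for elements of \<open>hardy2 p\<close>.\<close>

definition hardy2_norm :: "int \<Rightarrow> complex fps \<Rightarrow> real" where
  "hardy2_norm p f = sqrt (\<Sum>n. (cmod (fps_nth f n))\<^sup>2 * 2 powi (2 * int n * p))"

end

theory Submission
  imports Defs "HOL-Analysis.Convex"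
begin

text \<open>
  After rescaling, the weighted norms become plain \<open>\<ell>\<^sup>2\<close> norms, and the coefficients
  \<open>|f_n| 2^(-np)\<close> and \<open>|g_n| 2^(-np)\<close> are convolved. Young's inequality for
  \<open>\<ell>\<^sup>1 * \<ell>\<^sup>2\<close> bounds the convolution. The \<open>\<ell>\<^sup>1\<close> norm of the first sequence is, by
  Cauchy-Schwarz against the geometric sequence \<open>2^(-n(p-q))\<close>, at most
  \<open>(1 - 4^(-(p-q)))^(-1/2)\<close> times the norm of \<open>f\<close>, which is better than the claimed constant.
\<close>

text \<open>The finite Cauchy-Schwarz inequality bounds all partial sums by one constant. Since the
  terms are nonnegative, this bound gives both convergence and the estimate of the limit.\<close>

lemma Cauchy_Schwarz_suminf:
  fixes a b :: "nat \<Rightarrow> real"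
  assumes a: "summable (\<lambda>n. (a n)\<^sup>2)" and b: "summable (\<lambda>n. (b n)\<^sup>2)"
    and nonneg: "\<And>n. a n * b n \<ge> 0"
  shows "summable (\<lambda>n. a n * b n)"
    and "(\<Sum>n. a n * b n) \<le> sqrt (\<Sum>n. (a n)\<^sup>2) * sqrt (\<Sum>n. (b n)\<^sup>2)"
proof -
  have le: "(\<Sum>i<n. a i * b i) \<le> sqrt (\<Sum>n. (a n)\<^sup>2) * sqrt (\<Sum>n. (b n)\<^sup>2)" for n
  proof -
    have "(\<Sum>i<n. a i * b i)\<^sup>2 \<le> (\<Sum>i<n. (a i)\<^sup>2) * (\<Sum>i<n. (b i)\<^sup>2)"
      by (rule Cauchy_Schwarz_ineq_sum)
    also have "\<dots> \<le> (\<Sum>n. (a n)\<^sup>2) * (\<Sum>n. (b n)\<^sup>2)"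
      using a b by (intro mult_mono sum_le_suminf sum_nonneg suminf_nonneg) auto
    finally show ?thesis
      by (metis real_le_rsqrt real_sqrt_mult)
  qed
  show "summable (\<lambda>n. a n * b n)"
    by (rule summableI_nonneg_bounded[OF nonneg le])
  then show "(\<Sum>n. a n * b n) \<le> sqrt (\<Sum>n. (a n)\<^sup>2) * sqrt (\<Sum>n. (b n)\<^sup>2)"
    by (rule suminf_le_const) (rule le)
qed

text \<open>Cauchy-Schwarz with weights \<open>a m\<close> bounds each squared convolution term by
  \<open>S\<close> times a term of the convolution of \<open>a\<close> with the squares of
  \<open>b\<close>. Summing over \<open>n\<close> then produces a second factor
  \<open>S\<close>.\<close>

lemma Young_l1_l2:
  fixes a b :: "nat \<Rightarrow> real"
  assumes a: "summable a" and b: "summable (\<lambda>n. (b n)\<^sup>2)"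
    and nonneg: "\<And>n. a n \<ge> 0"
  shows "summable (\<lambda>n. (\<Sum>m\<le>n. a m * b (n - m))\<^sup>2)"
    and "(\<Sum>n. (\<Sum>m\<le>n. a m * b (n - m))\<^sup>2) \<le> (\<Sum>n. a n)\<^sup>2 * (\<Sum>n. (b n)\<^sup>2)"
proof -
  define S where "S = (\<Sum>n. a n)"
  have pointwise: "(\<Sum>m\<le>n. a m * b (n - m))\<^sup>2 \<le> S * (\<Sum>m\<le>n. a m * (b (n - m))\<^sup>2)" for n
  proof -
    \<comment> \<open>Half of each weight is moved to either factor, so that squaring restores
      \<open>a m\<close> in both sums.\<close>
    have "(\<Sum>m\<le>n. a m * b (n - m)) = (\<Sum>m\<le>n. sqrt (a m) * (sqrt (a m) * b (n - m)))"
      using nonneg by (simp flip: mult.assoc)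
    then have "(\<Sum>m\<le>n. a m * b (n - m))\<^sup>2
        \<le> (\<Sum>m\<le>n. (sqrt (a m))\<^sup>2) * (\<Sum>m\<le>n. (sqrt (a m) * b (n - m))\<^sup>2)"
      by (simp only: Cauchy_Schwarz_ineq_sum)
    also have "\<dots> = (\<Sum>m\<le>n. a m) * (\<Sum>m\<le>n. a m * (b (n - m))\<^sup>2)"
      using nonneg by (simp add: power_mult_distrib)
    also have "\<dots> \<le> S * (\<Sum>m\<le>n. a m * (b (n - m))\<^sup>2)"
      unfolding S_def using a nonneg
      by (intro mult_right_mono sum_le_suminf sum_nonneg) auto
    finally show ?thesis .
  qed
  \<comment> \<open>Both series have nonnegative terms, hence converge absolutely, and their Cauchy
    product sums to the product of the sums.\<close>
  have "(\<lambda>n. \<Sum>m\<le>n. a m * (b (n - m))\<^sup>2) sums (S * (\<Sum>n. (b n)\<^sup>2))"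
    unfolding S_def using a b nonneg by (intro Cauchy_product_sums) auto
  then have bound: "(\<lambda>n. S * (\<Sum>m\<le>n. a m * (b (n - m))\<^sup>2)) sums (S * (S * (\<Sum>n. (b n)\<^sup>2)))"
    by (rule sums_mult)
  show summable: "summable (\<lambda>n. (\<Sum>m\<le>n. a m * b (n - m))\<^sup>2)"
    by (rule summable_comparison_test'[OF sums_summable[OF bound], of 0])
      (use pointwise in simp)
  have "(\<Sum>n. (\<Sum>m\<le>n. a m * b (n - m))\<^sup>2) \<le> S * (S * (\<Sum>n. (b n)\<^sup>2))"
    using suminf_le[OF pointwise summable sums_summable[OF bound]] bound
    by (simp add: sums_iff)
  then show "(\<Sum>n. (\<Sum>m\<le>n. a m * b (n - m))\<^sup>2) \<le> (\<Sum>n. a n)\<^sup>2 * (\<Sum>n. (b n)\<^sup>2)"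
    by (simp add: S_def power2_eq_square mult.assoc)
qed

text \<open>The natural \<open>p\<close> stands for the radius \<open>2^(-p)\<close>. Writing the
  weight as a natural power of \<open>1/2\<close> lets it split by \<open>power_add\<close> and
  \<open>power_mult\<close>.\<close>

definition weighted_coeff :: "nat \<Rightarrow> complex fps \<Rightarrow> nat \<Rightarrow> real" where
  "weighted_coeff p f n = cmod (fps_nth f n) * (1/2) ^ (n * p)"

lemma weighted_coeff_nonneg [simp]: "weighted_coeff p f n \<ge> 0"
  by (simp add: weighted_coeff_def)

lemma weighted_coeff_sq:
  "(cmod (fps_nth f n))\<^sup>2 * 2 powi (2 * int n * - int p) = (weighted_coeff p f n)\<^sup>2"
proof -
  have "2 * int n * - int p = - int (n * p * 2)"
    by simp
  then have "(2::real) powi (2 * int n * - int p) = inverse (2 ^ (n * p * 2))"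
    by (simp only: power_int_minus power_int_of_nat)
  also have "\<dots> = ((1/2) ^ (n * p))\<^sup>2"
    by (simp only: power_one_over inverse_eq_divide power_mult power_divide power_one)
  finally show ?thesis
    by (simp add: weighted_coeff_def power_mult_distrib)
qed

lemma mem_hardy2_uminus_iff:
  "f \<in> hardy2 (- int p) \<longleftrightarrow> summable (\<lambda>n. (weighted_coeff p f n)\<^sup>2)"
  by (simp only: hardy2_def weighted_coeff_sq mem_Collect_eq)

lemma hardy2_norm_uminus:
  "hardy2_norm (- int p) f = sqrt (\<Sum>n. (weighted_coeff p f n)\<^sup>2)"
  by (simp only: hardy2_norm_def weighted_coeff_sq)

text \<open>The weight is multiplicative in the index, so it distributes over the two factors of
  each term once the triangle inequality is applied to the Cauchy product.\<close>

lemma weighted_coeff_mult_le: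
  "weighted_coeff p (f * g) n \<le> (\<Sum>m\<le>n. weighted_coeff p f m * weighted_coeff p g (n - m))"
proof -
  have "weighted_coeff p (f * g) n
      \<le> (\<Sum>m\<le>n. cmod (fps_nth f m * fps_nth g (n - m))) * (1/2) ^ (n * p)"
    unfolding weighted_coeff_def fps_mult_nth atLeast0AtMost
    by (intro mult_right_mono norm_sum) auto
  also have "\<dots> = (\<Sum>m\<le>n. weighted_coeff p f m * weighted_coeff p g (n - m))"
    unfolding sum_distrib_right
  proof (rule sum.cong)
    fix m assume "m \<in> {..n}"
    \<comment> \<open>The bound \<open>m \<le> n\<close> matters here, as subtraction on naturals
      truncates.\<close>
    then have "n * p = m * p + (n - m) * p"
      by (simp flip: add_mult_distrib)
    then show "cmod (fps_nth f m * fps_nth g (n - m)) * (1/2) ^ (n * p)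
        = weighted_coeff p f m * weighted_coeff p g (n - m)"
      by (simp add: weighted_coeff_def norm_mult power_add)
  qed simp
  finally show ?thesis .
qed

text \<open>Shrinking the radius from \<open>2^(-q)\<close> to \<open>2^(-p)\<close> gains the
  factor \<open>2^(-n(p-q))\<close>, whose squares form a geometric series of ratio
  \<open>4^(-(p-q)) < 1\<close>.\<close>

lemma weighted_coeff_l1:
  assumes "p > q" and f: "f \<in> hardy2 (- int q)"
  shows "summable (weighted_coeff p f)"
    and "(\<Sum>n. weighted_coeff p f n)
      \<le> hardy2_norm (- int q) f * sqrt (inverse (1 - (1/4) ^ (p - q)))"
proof -
  have split: "weighted_coeff p f n = weighted_coeff q f n * ((1/2) ^ (p - q)) ^ n" for n
  proof -
    have "n * p = n * (q + (p - q))"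
      using \<open>p > q\<close> by simp
    also have "\<dots> = n * q + (p - q) * n"
      by (simp only: add_mult_distrib2 mult.commute[of "p - q"])
    finally show ?thesis
      by (simp add: weighted_coeff_def power_add power_mult)
  qed
  have sq: "(((1/2) ^ (p - q)) ^ n)\<^sup>2 = ((1/4) ^ (p - q) :: real) ^ n" for n
  proof -
    have "(((1/2) ^ (p - q)) ^ n)\<^sup>2 = (((1/2)\<^sup>2) ^ (p - q) :: real) ^ n"
      by (metis mult.commute power_mult)
    then show ?thesis
      by (simp add: power2_eq_square)
  qed
  have lt: "norm ((1/4) ^ (p - q) :: real) < 1"
    using \<open>p > q\<close> by (simp add: power_less_one_iff)
  note l1 = Cauchy_Schwarz_suminf[of "weighted_coeff q f" "\<lambda>n. ((1/2) ^ (p - q)) ^ n"]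
  show "summable (weighted_coeff p f)"
    unfolding split[abs_def]
    by (rule l1) (use f lt in \<open>simp_all add: mem_hardy2_uminus_iff sq summable_geometric\<close>)
  have "(\<Sum>n. weighted_coeff p f n) \<le> sqrt (\<Sum>n. (weighted_coeff q f n)\<^sup>2)
      * sqrt (\<Sum>n. (((1/2) ^ (p - q)) ^ n)\<^sup>2)"
    unfolding split
    by (rule l1) (use f lt in \<open>simp_all add: mem_hardy2_uminus_iff sq summable_geometric\<close>)
  then show "(\<Sum>n. weighted_coeff p f n)
      \<le> hardy2_norm (- int q) f * sqrt (inverse (1 - (1/4) ^ (p - q)))"
    using suminf_geometric[OF lt] by (simp only: sq hardy2_norm_uminus inverse_eq_divide)
qed

theorem theorem4p3:
  fixes p q :: nat and f g :: "complex fps"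
  assumes "p > q"
    and "f \<in> hardy2 (- int q)"
    and "g \<in> hardy2 (- int p)"
  shows "f * g \<in> hardy2 (- int p) \<and>
    hardy2_norm (- int p) (f * g)
      \<le> inverse (1 - 4 powi (- (int p - int q)))
          * hardy2_norm (- int q) f * hardy2_norm (- int p) g"
proof -
  define r :: real where "r = (1/4) ^ (p - q)"
  define S where "S = (\<Sum>n. weighted_coeff p f n)"
  let ?c = "\<lambda>n. \<Sum>m\<le>n. weighted_coeff p f m * weighted_coeff p g (n - m)"
  have r: "0 < r" "r < 1"
    using \<open>p > q\<close> by (simp_all add: r_def power_less_one_iff)
  have "- (int p - int q) = - int (p - q)"
    using \<open>p > q\<close> by simp
  then have r_powi: "4 powi (- (int p - int q)) = r"
    by (simp only: power_int_minus power_int_of_nat r_def power_one_over inverse_eq_divide)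
  note l1 = weighted_coeff_l1[OF assms(1,2), folded r_def]
  note g = assms(3)[unfolded mem_hardy2_uminus_iff]
  note young = Young_l1_l2[OF l1(1) g weighted_coeff_nonneg]
  have le: "(weighted_coeff p (f * g) n)\<^sup>2 \<le> (?c n)\<^sup>2" for n
    by (intro power_mono weighted_coeff_mult_le) simp
  have summable: "summable (\<lambda>n. (weighted_coeff p (f * g) n)\<^sup>2)"
    by (rule summable_comparison_test'[OF young(1), of 0]) (use le in simp)
  have "S \<ge> 0"
    unfolding S_def by (intro suminf_nonneg l1) simp
  \<comment> \<open>Membership supplies summability, without which the infinite sum under the root
    is unspecified.\<close>
  have norm_nonneg: "hardy2_norm (- int k) h \<ge> 0" if "h \<in> hardy2 (- int k)" for k h
    using that by (simp add: hardy2_norm_uminus mem_hardy2_uminus_iff suminf_nonneg)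
  have "(\<Sum>n. (weighted_coeff p (f * g) n)\<^sup>2) \<le> S\<^sup>2 * (\<Sum>n. (weighted_coeff p g n)\<^sup>2)"
    unfolding S_def using suminf_le[OF le summable young(1)] young(2) by (rule order_trans)
  then have "hardy2_norm (- int p) (f * g) \<le> sqrt (S\<^sup>2 * (\<Sum>n. (weighted_coeff p g n)\<^sup>2))"
    by (simp add: hardy2_norm_uminus)
  also have "\<dots> = S * hardy2_norm (- int p) g"
    using \<open>S \<ge> 0\<close> by (simp add: hardy2_norm_uminus real_sqrt_mult)
  also have "\<dots> \<le> (hardy2_norm (- int q) f * sqrt (inverse (1 - r))) * hardy2_norm (- int p) g"
    unfolding S_def by (intro mult_right_mono l1 norm_nonneg assms)
  \<comment> \<open>The sharper constant is weakened to the claimed one: a number that is at least 1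
    dominates its square root.\<close>
  also have "\<dots> \<le> (hardy2_norm (- int q) f * inverse (1 - r)) * hardy2_norm (- int p) g"
  proof (intro mult_right_mono mult_left_mono norm_nonneg assms)
    have "1 \<le> inverse (1 - r)"
      using r by (simp add: one_le_inverse_iff)
    then show "sqrt (inverse (1 - r)) \<le> inverse (1 - r)"
      using r self_le_power[of "inverse (1 - r)" 2] by (intro real_le_lsqrt) auto
  qed
  finally show ?thesis
    using summable unfolding r_powi by (simp add: mem_hardy2_uminus_iff mult_ac)
qed

end
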